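(* Let $f$ be a PWL orientation preserving homeomorphism of the circle with $n$ break points $b_1,\dots,b_n$ and rational rotation number. If $f$ is topologically conjugate to a rigid rational rotation, then $\{1,2,\dots,n\}$ can be partitioned into $K$ disjoint sets $S_r$, $r=1,\dots,K$, for some $1\le K\le n/2$, such that each set $S_r$ contains at least two elements, if $u,v\in S_r$ then $b_u$ and $b_v$ lie on the same periodic orbit of $f$, and $f$ has trivial cancellations on $S_r$.
   Context: The circle $\mathbb{S}^1=\mathbb{R}/\mathbb{Z}$ is parametrized by $x\in[0,1)$. An orientation preserving homeomorphism $f$ of the circle is described by a lift $F:\mathbb{R}\to\mathbb{R}$, continuous and strictly increasing with $F(x+1)=F(x)+1$ and $f(x)=F(x)\ (\mathrm{mod}\ 1)$; two lifts of $f$ differ by an integer. $f$ is piecewise linear (PWL) if there is a finite set of break points $0\le b_1<b_2<\dots<b_n<1$ such that $F$ is affine on each interval $(b_i,b_{i+1})$, $1\le i\le n-1$, and on $(b_n,b_1+1)$, and at each break point $F'(b_{i,-})=\lim_{x\uparrow b_i}F'(x)\neq\lim_{x\downarrow b_i}F'(x)=F'(b_{i,+})$. (A PWL map has $n\ge 2$ break points.) The rotation number of a lift is $\rho(F)=\lim_{m\to\infty}\frac1m(F^m(x)-x)$ (it exists and is independent of $x$), and $\rho(f)=\rho(F)\ (\mathrm{mod}\ 1)$. A rigid rational rotation is a map $r_\omega(x)=x+\omega\ (\mathrm{mod}\ 1)$ with $\omega$ rational. Maps $f,g$ of the circle are topologically conjugate if there is a homeomorphism $h$ of the circle with $h\circ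 f=g\circ h$. The jump at a break point is $J(b_i)=F'(b_{i,+})/F'(b_{i,-})$. For a set $S\subset\{1,\dots,n\}$ of $p$ distinct indices, $1<p\le n$, $f$ has trivial cancellations on $S$ if $\prod_{i\in S}J(b_i)=1$. *)

theory Defs
  imports "HOL-Analysis.Analysis"
begin

text \<open>
  The circle \<open>\<real>/\<int>\<close> is carried by the representatives \<open>{0..<1}\<close> and has the quotient topology
  along \<open>frac\<close>, i.e. reduction modulo 1 (see \<open>quotient_map_frac\<close>).  A map of the circle is a
  function on reals of which only the values on \<open>{0..<1}\<close> matter.
\<close>

definition circle :: "real topology" where
  "circle = topology (\<lambda>U. U \<subseteq> {0..<1} \<and> open {x. frac x \<in> U})"

lemma openin_circle: "openin circle U \<longleftrightarrow> U \<subseteq> {0..<1} \<and> open {x. frac x \<in> U}"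
proof -
  have "istopology (\<lambda>U. U \<subseteq> {0..<1::real} \<and> open {x::real. frac x \<in> U})"
    unfolding istopology_def
  proof (intro conjI allI impI)
    fix S T :: "real set"
    assume S: "S \<subseteq> {0..<1} \<and> open {x. frac x \<in> S}" and T: "T \<subseteq> {0..<1} \<and> open {x. frac x \<in> T}"
    show "S \<inter> T \<subseteq> {0..<1}" using S by blast
    have "{x. frac x \<in> S \<inter> T} = {x. frac x \<in> S} \<inter> {x. frac x \<in> T}" by blast
    then show "open {x. frac x \<in> S \<inter> T}" using S T by (simp add: open_Int)
  next
    fix \<K> :: "real set set"
    assume K: "\<forall>K\<in>\<K>. K \<subseteq> {0..<1} \<and> open {x. frac x \<in> K}"
    show "\<Union>\<K> \<subseteq> {0..<1}" using K by blast
    have "{x. frac x \<in> \<Union>\<K>} = (\<Union>K\<in>\<K>. {x. frac x \<in> K})" by blast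
    then show "open {x. frac x \<in> \<Union>\<K>}" using K by auto
  qed
  then show ?thesis
    unfolding circle_def by (simp add: topology_inverse')
qed

lemma frac_in_circle: "frac (x::real) \<in> {0..<1}"
  by (simp add: frac_lt_1)

lemma topspace_circle: "topspace circle = {0..<1}"
proof -
  have "openin circle {0..<1}"
    by (simp add: openin_circle frac_lt_1)
  then show ?thesis
    by (metis openin_circle openin_subset openin_topspace subset_antisym)
qed

lemma quotient_map_frac: "quotient_map euclidean circle (frac :: real \<Rightarrow> real)"
proof -
  have "frac ` (UNIV :: real set) = {0..<1}"
  proof
    show "frac ` (UNIV :: real set) \<subseteq> {0..<1}" using frac_in_circle by blast
    show "{0..<1} \<subseteq> frac ` (UNIV :: real set)"
    proof
      fix x :: real assume "x \<in> {0..<1}"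
      then have "frac x = x" by (simp add: frac_eq)
      then show "x \<in> range frac" by (metis rangeI)
    qed
  qed
  then show ?thesis
    by (auto simp: quotient_map_def topspace_circle openin_circle)
qed

definition is_lift :: "(real \<Rightarrow> real) \<Rightarrow> (real \<Rightarrow> real) \<Rightarrow> bool" where
  "is_lift F f \<longleftrightarrow> continuous_on UNIV F \<and> strict_mono F \<and> (\<forall>x. F (x + 1) = F x + 1) \<and>
     (\<forall>x\<in>{0..<1}. f x = frac (F x))"

definition orientation_preserving_homeo :: "(real \<Rightarrow> real) \<Rightarrow> bool" where
  "orientation_preserving_homeo f \<longleftrightarrow> homeomorphic_map circle circle f \<and> (\<exists>F. is_lift F f)"

definition left_slope :: "(real \<Rightarrow> real) \<Rightarrow> real \<Rightarrow> real" where
  "left_slope F x = Lim (at_left x) (deriv F)"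

definition right_slope :: "(real \<Rightarrow> real) \<Rightarrow> real \<Rightarrow> real" where
  "right_slope F x = Lim (at_right x) (deriv F)"

definition affine_map_on :: "real set \<Rightarrow> (real \<Rightarrow> real) \<Rightarrow> bool" where
  "affine_map_on A F \<longleftrightarrow> (\<exists>a c. \<forall>x\<in>A. F x = a * x + c)"

text \<open>
  The piecewise linear condition on a lift \<open>F\<close>, with break points \<open>b 1 < \<dots> < b n\<close>.  Since lifts of
  the same map differ by integer constants, this and the jumps below do not depend on the lift.
  The requirement \<open>2 \<le> n\<close> only excludes \<open>n = 0\<close> (a single break point is impossible, the slope
  being periodic).
\<close>

definition pwl :: "(real \<Rightarrow> real) \<Rightarrow> nat \<Rightarrow> (nat \<Rightarrow> real) \<Rightarrow> bool" where
  "pwl F n b \<longleftrightarrow> 2 \<le> n \<and> 0 \<le> b 1 \<and> strict_mono_on {1..n} b \<and> b n < 1 \<and>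
     (\<forall>i\<in>{1..<n}. affine_map_on {b i<..<b (i + 1)} F) \<and>
     affine_map_on {b n<..<b 1 + 1} F \<and>
     (\<forall>i\<in>{1..n}. left_slope F (b i) \<noteq> right_slope F (b i))"

definition jump :: "(real \<Rightarrow> real) \<Rightarrow> real \<Rightarrow> real" where
  "jump F x = right_slope F x / left_slope F x"

text \<open>For a lift \<open>F\<close> the limit exists and is the same for all \<open>x\<close>, so the description is definite.\<close>

definition lift_rotation_number :: "(real \<Rightarrow> real) \<Rightarrow> real" where
  "lift_rotation_number F =
     (THE \<rho>. \<forall>x. (\<lambda>m. ((F ^^ m) x - x) / real m) \<longlonglongrightarrow> \<rho>)"

text \<open>The rotation number of the circle map with lift \<open>F\<close>.\<close>

definition rotation_number :: "(real \<Rightarrow> real) \<Rightarrow> real" where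
  "rotation_number F = frac (lift_rotation_number F)"

definition rigid_rotation :: "real \<Rightarrow> real \<Rightarrow> real" where
  "rigid_rotation \<omega> x = frac (x + \<omega>)"

definition topologically_conjugate :: "(real \<Rightarrow> real) \<Rightarrow> (real \<Rightarrow> real) \<Rightarrow> bool" where
  "topologically_conjugate f g \<longleftrightarrow>
     (\<exists>h. homeomorphic_map circle circle h \<and> (\<forall>x\<in>{0..<1}. h (f x) = g (h x)))"

definition periodic_orbit :: "(real \<Rightarrow> real) \<Rightarrow> real set \<Rightarrow> bool" where
  "periodic_orbit f A \<longleftrightarrow>
     (\<exists>x\<in>{0..<1}. \<exists>q\<ge>1. (f ^^ q) x = x \<and> A = range (\<lambda>k. (f ^^ k) x))"

definition trivial_cancellations ::
    "(real \<Rightarrow> real) \<Rightarrow> nat \<Rightarrow> (nat \<Rightarrow> real) \<Rightarrow> nat set \<Rightarrow> bool" where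
  "trivial_cancellations F n b S \<longleftrightarrow>
     S \<subseteq> {1..n} \<and> 1 < card S \<and> (\<Prod>i\<in>S. jump F (b i)) = 1"

end

theory Submission
  imports Defs "HOL-Combinatorics.Orbits"
begin

text \<open>
  A map conjugate to a rotation by \<open>p/q\<close> satisfies \<open>f\<^sup>q = id\<close>, so its lift satisfies
  \<open>F\<^sup>q(x) = x + m\<close> for one integer \<open>m\<close> (\<open>periodic_of_conjugate_rational_rotation\<close>,
  \<open>lift_of_identity\<close>).  As \<open>F\<close> is increasing, the chain rule holds for right
  derivatives and for left derivatives separately.  Hence along \<open>x, f x, \<dots>, f\<^sup>q\<^sup>-\<^sup>1 x\<close> the right
  slopes of \<open>F\<close> multiply to \<open>1\<close>, the left slopes do so too, and therefore so do the jumps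
  (\<open>prod_one_sided_slopes\<close>, \<open>prod_jumps_along_period\<close>).

  If the orbit of \<open>x\<close> has least period \<open>d\<close>, then the product \<open>P\<close> of the jumps over the orbit has a
  positive power equal to \<open>1\<close>, and \<open>P > 0\<close>, so \<open>P = 1\<close> (\<open>prod_jumps_orbit\<close>).  Only the break points have a jump other
  than \<open>1\<close>, so the break points on each orbit already have jumps with product \<open>1\<close>
  (\<open>prod_jumps_breaks_on_orbit\<close>); in particular, an orbit cannot carry exactly one of them
  (\<open>two_breaks_on_orbit\<close>).  The sets \<open>S\<^sub>r\<close> are the classes of break points lying
  on a common orbit, and each having at least two elements bounds their number by \<open>n/2\<close>.
\<close>

section \<open>Lifts\<close>

lemma lift_add_int:
  assumes "is_lift F f"
  shows "F (x + of_int k) = F x + of_int k"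
proof (induction k rule: int_induct[where k = 0])
  case base
  then show ?case by simp
next
  case (step1 i)
  have "F (x + of_int i + 1) = F (x + of_int i) + 1"
    using assms by (simp add: is_lift_def)
  then show ?case using step1 by (simp add: add_ac)
next
  case (step2 i)
  have "F (x + of_int (i - 1) + 1) = F (x + of_int (i - 1)) + 1"
    using assms unfolding is_lift_def by blast
  then show ?case using step2 by (simp add: algebra_simps)
qed

lemma lift_frac: "is_lift F f \<Longrightarrow> F (frac x) = F x - of_int \<lfloor>x\<rfloor>"
  using lift_add_int[of F f "frac x" "\<lfloor>x\<rfloor>"] by (simp add: frac_def)

lemma frac_eq_add_int: "y = x + of_int k \<Longrightarrow> frac y = frac x"
  by (simp add: frac_def)

lemma is_lift_funpow:
  assumes F: "is_lift F f"
  shows "is_lift (F ^^ k) (f ^^ k)"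
proof (induction k)
  case 0
  show ?case
    by (auto simp: is_lift_def strict_mono_def intro!: continuous_intros)
next
  case (Suc k)
  have "continuous_on UNIV (F ^^ Suc k)"
    using F Suc continuous_on_compose[of UNIV "F ^^ k" F]
    by (auto simp: is_lift_def o_def intro: continuous_on_subset)
  moreover have "strict_mono (F ^^ Suc k)"
    using F Suc by (auto simp: is_lift_def strict_mono_def)
  moreover have "(f ^^ Suc k) x = frac ((F ^^ Suc k) x)" if x: "x \<in> {0..<1}" for x
  proof -
    have "(f ^^ Suc k) x = frac (F (frac ((F ^^ k) x)))"
      using F Suc x by (simp add: is_lift_def frac_lt_1)
    then show ?thesis
      by (simp add: lift_frac[OF F] frac_eq_add_int[of _ _ "- \<lfloor>(F ^^ k) x\<rfloor>"])
  qed
  ultimately show ?case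
    using F Suc by (simp add: is_lift_def o_def)
qed

text \<open>
  The displacement \<open>G x - x\<close> is continuous in \<open>x\<close> and takes only integer values, so it cannot vary.
\<close>

lemma lift_of_identity:
  assumes G: "is_lift G g" and id: "\<And>x. x \<in> {0..<1} \<Longrightarrow> g x = x"
  shows "\<exists>m. \<forall>x. G x = x + of_int m"
proof -
  have int: "G x - x \<in> \<int>" for x
  proof -
    have "frac (G (frac x)) = frac x"
      using G id[of "frac x"] by (auto simp: is_lift_def frac_lt_1)
    then have "G (frac x) - frac x \<in> \<int>"
      by (metis frac_unique_iff)
    moreover have "G (frac x) - frac x = G x - x"
      by (simp add: lift_frac[OF G]) (simp add: frac_def)
    ultimately show ?thesis by simp
  qed
  have "(\<lambda>x. G x - x) constant_on UNIV"
  proof (rule continuous_discrete_range_constant)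
    show "continuous_on UNIV (\<lambda>x. G x - x)"
      using G by (auto simp: is_lift_def intro!: continuous_intros)
    fix x
    have "1 \<le> norm ((G y - y) - (G x - x))" if "G y - y \<noteq> G x - x" for y
    proof -
      have "(G y - y) - (G x - x) \<in> \<int>" using int by (rule Ints_diff) (rule int)
      then show ?thesis using that by (auto simp: Ints_nonzero_abs_ge1)
    qed
    then show "\<exists>e>0. \<forall>y. y \<in> UNIV \<and> G y - y \<noteq> G x - x \<longrightarrow> e \<le> norm (G y - y - (G x - x))"
      by (intro exI[of _ 1]) auto
  qed simp
  then obtain c where c: "\<And>x. G x - x = c" by (auto simp: constant_on_def)
  then obtain m where "c = of_int m" using int[of 0] by (metis Ints_cases)
  then show ?thesis using c by (metis add.commute diff_eq_eq)
qed

text \<open>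
  The rotation by \<open>a/b\<close> returns every point after \<open>b\<close> turns, and the conjugacy \<open>h\<close> is injective on
  the circle, so \<open>f\<close> does the same.
\<close>

lemma periodic_of_conjugate_rational_rotation:
  assumes F: "is_lift F f" and "\<omega> \<in> \<rat>" and "topologically_conjugate f (rigid_rotation \<omega>)"
  shows "\<exists>q\<ge>1. \<forall>x\<in>{0..<1}. (f ^^ q) x = x"
proof -
  obtain a b :: int where b: "b > 0" and \<omega>: "\<omega> = of_int a / of_int b"
    using \<open>\<omega> \<in> \<rat>\<close> by (rule Rats_cases')
  obtain h where h: "homeomorphic_map circle circle h"
    and conj: "\<And>x. x \<in> {0..<1} \<Longrightarrow> h (f x) = rigid_rotation \<omega> (h x)"
    using assms(3) by (auto simp: topologically_conjugate_def)
  have inj: "inj_on h {0..<1}" and img: "h ` {0..<1} = {0..<1}"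
    using homeomorphic_imp_injective_map[OF h] homeomorphic_imp_surjective_map[OF h]
    by (simp_all add: topspace_circle)
  have f_in: "(f ^^ k) x \<in> {0..<1}" if "x \<in> {0..<1}" for k x
    using is_lift_funpow[OF F, of k] that by (simp add: is_lift_def frac_lt_1)
  have hk: "h ((f ^^ k) x) = frac (h x + of_nat k * \<omega>)" if x: "x \<in> {0..<1}" for k x
  proof (induction k)
    case 0
    have "h x \<in> {0..<1}" using img x by blast
    then show ?case by simp
  next
    case (Suc k)
    have "h ((f ^^ Suc k) x) = frac (frac (h x + of_nat k * \<omega>) + \<omega>)"
      using conj[OF f_in[OF x, of k]] Suc by (simp add: rigid_rotation_def)
    also have "\<dots> = frac (h x + of_nat (Suc k) * \<omega>)"
      by (rule frac_eq_add_int[where k = "- \<lfloor>h x + of_nat k * \<omega>\<rfloor>"])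
        (simp add: frac_def algebra_simps)
    finally show ?case .
  qed
  have "(f ^^ nat b) x = x" if x: "x \<in> {0..<1}" for x
  proof -
    have hx: "h x \<in> {0..<1}" using img x by blast
    have "of_nat (nat b) * \<omega> = of_int a" using b \<omega> by simp
    then have "h ((f ^^ nat b) x) = frac (h x)"
      using hk[OF x, of "nat b"] frac_eq_add_int[of "h x + of_int a" "h x" a] by simp
    then have "h ((f ^^ nat b) x) = h x" using hx by simp
    then show ?thesis using inj_onD[OF inj] f_in[OF x] x by blast
  qed
  then show ?thesis using b by (intro exI[of _ "nat b"]) auto
qed

section \<open>One-sided slopes\<close>

text \<open>
  Slopes are defined as limits of \<open>deriv F\<close>, while the chain rule needs one-sided derivatives at the
  point itself; next to an affine piece \<open>T\<close> the two agree.  Any \<open>T\<close> that accumulates at \<open>x\<close> is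
  allowed, so that an interval ending at \<open>x\<close> and one starting there are treated at once.
\<close>

lemma slope_of_affine:
  assumes "open T" and "at x within T \<noteq> bot"
    and aff: "\<And>t. t \<in> T \<Longrightarrow> F t = a * t + c" and x: "F x = a * x + c"
  shows "Lim (at x within T) (deriv F) = a" "(F has_real_derivative a) (at x within T)"
proof -
  have lin: "((\<lambda>t. a * t + c) has_real_derivative a) (at t within S)" for t S
    by (auto intro!: derivative_eq_intros)
  have "deriv F t = a" if "t \<in> T" for t
    by (intro DERIV_imp_deriv has_field_derivative_transform_within_open[OF lin \<open>open T\<close> that])
      (simp add: aff)
  then have "\<forall>\<^sub>F t in at x within T. deriv F t = a"
    by (auto simp: eventually_at_filter)
  then show "Lim (at x within T) (deriv F) = a"
    using assms(2) by (intro tendsto_Lim tendsto_eventually) auto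
  have "\<forall>\<^sub>F t in at x within T. F t = a * t + c"
    using aff by (auto simp: eventually_at_filter)
  then show "(F has_real_derivative a) (at x within T)"
    using lin x by (subst has_field_derivative_cong_eventually) auto
qed

lemma right_slope_of_affine:
  assumes "u \<le> x" "x < v" and aff: "\<And>t. t \<in> {u..v} \<Longrightarrow> F t = a * t + c"
  shows "right_slope F x = a" "(F has_real_derivative a) (at_right x)"
proof -
  have eq: "at x within {x<..<v} = at_right x"
    using \<open>x < v\<close> by (intro at_within_nhd[of x "{..<v}"]) auto
  have ne: "at x within {x<..<v} \<noteq> bot" by (simp add: eq)
  have "F t = a * t + c" if "t \<in> {x<..<v}" for t using that assms by simp
  moreover have "F x = a * x + c" using assms by simp
  ultimately show "right_slope F x = a" "(F has_real_derivative a) (at_right x)"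
    using slope_of_affine[OF open_greaterThanLessThan ne, of F a c]
    by (simp_all add: eq right_slope_def)
qed

lemma left_slope_of_affine:
  assumes "u < x" "x \<le> v" and aff: "\<And>t. t \<in> {u..v} \<Longrightarrow> F t = a * t + c"
  shows "left_slope F x = a" "(F has_real_derivative a) (at_left x)"
proof -
  have eq: "at x within {u<..<x} = at_left x"
    using \<open>u < x\<close> by (intro at_within_nhd[of x "{u<..}"]) auto
  have ne: "at x within {u<..<x} \<noteq> bot" by (simp add: eq)
  have "F t = a * t + c" if "t \<in> {u<..<x}" for t using that assms by simp
  moreover have "F x = a * x + c" using assms by simp
  ultimately show "left_slope F x = a" "(F has_real_derivative a) (at_left x)"
    using slope_of_affine[OF open_greaterThanLessThan ne, of F a c]
    by (simp_all add: eq left_slope_def)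
qed

lemma strict_mono_affine_slope_pos:
  fixes F :: "real \<Rightarrow> real"
  assumes "strict_mono F" "u < v" "\<And>t. t \<in> {u..v} \<Longrightarrow> F t = a * t + c"
  shows "0 < a"
proof -
  have "F u < F v" using assms(1,2) by (rule strict_monoD)
  then have "0 < a * (v - u)" using assms(3)[of u] assms(3)[of v] \<open>u < v\<close> by (simp add: right_diff_distrib)
  then show ?thesis using \<open>u < v\<close> by (simp add: zero_less_mult_iff)
qed

text \<open>
  The image condition says that \<open>F\<close> keeps the side: an increasing map sends points to the right of
  \<open>x\<close> to points to the right of \<open>F x\<close>.
\<close>

lemma one_sided_derivative_funpow:
  fixes F :: "real \<Rightarrow> real" and T :: "real \<Rightarrow> real set"
  assumes der: "\<And>x. (F has_real_derivative D x) (at x within T x)"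
    and img: "\<And>x. F ` T x \<subseteq> T (F x)"
  shows "((F ^^ k) has_real_derivative (\<Prod>j<k. D ((F ^^ j) x))) (at x within T x)"
proof (induction k)
  case 0
  show ?case by (auto simp: id_def)
next
  case (Suc k)
  have "(F ^^ k) ` T x \<subseteq> T ((F ^^ k) x)"
  proof (induction k)
    case (Suc k)
    then show ?case using img[of "(F ^^ k) x"] by auto
  qed simp
  then have "(F has_real_derivative D ((F ^^ k) x)) (at ((F ^^ k) x) within (F ^^ k) ` T x)"
    by (rule DERIV_subset[OF der])
  from DERIV_image_chain[OF this Suc] show ?case by (simp add: mult.commute o_def)
qed

text \<open>
  The product is the one-sided derivative of \<open>F\<^sup>q\<close> by the chain rule, and a translation has
  derivative \<open>1\<close> on each side.
\<close>

lemma prod_one_sided_slopes: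
  fixes F :: "real \<Rightarrow> real" and T :: "real \<Rightarrow> real set"
  assumes "\<And>x. (F has_real_derivative D x) (at x within T x)"
    and "\<And>x. F ` T x \<subseteq> T (F x)"
    and "at x within T x \<noteq> bot" and trans: "\<And>x. (F ^^ q) x = x + m"
  shows "(\<Prod>j<q. D ((F ^^ j) x)) = 1"
proof (rule has_field_derivative_unique)
  show "((F ^^ q) has_real_derivative (\<Prod>j<q. D ((F ^^ j) x))) (at x within T x)"
    using assms(1,2) by (rule one_sided_derivative_funpow)
  have "F ^^ q = (\<lambda>x. x + m)" using trans by auto
  then show "((F ^^ q) has_real_derivative 1) (at x within T x)"
    by (auto intro!: derivative_eq_intros)
qed fact

section \<open>Products along periodic orbits\<close>

lemma prod_along_repeated_period:
  fixes g :: "'b \<Rightarrow> 'a :: comm_monoid_mult"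
  assumes "(f ^^ d) x = x"
  shows "(\<Prod>j<d * e. g ((f ^^ j) x)) = (\<Prod>j<d. g ((f ^^ j) x)) ^ e"
proof (induction e)
  case (Suc e)
  have split: "(\<Prod>j<m + k. h j) = (\<Prod>j<m. h j) * (\<Prod>j<k. h (m + j))" for m k and h :: "nat \<Rightarrow> 'a"
    by (induction k) (simp_all add: mult.assoc)
  have "(f ^^ (d * e)) x = x"
    using funpow_mod_eq[OF assms, of "d * e"] by simp
  then have "(f ^^ (d * e + j)) x = (f ^^ j) x" for j
    by (simp add: add.commute[of "d * e"] funpow_add)
  then show ?case
    using split[of "\<lambda>j. g ((f ^^ j) x)" "d * e" d] Suc by (simp add: add.commute mult.commute)
qed simp

section \<open>Piecewise linear lifts\<close>

lemma affine_map_on_closed_interval: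
  assumes "continuous_on UNIV F" and "u < v" and "affine_map_on {u<..<v} F"
  shows "\<exists>a c. \<forall>t\<in>{u..v}. F t = a * t + c"
proof -
  obtain a c where ac: "\<And>t. t \<in> {u<..<v} \<Longrightarrow> F t = a * t + c"
    using assms by (auto simp: affine_map_on_def)
  have "F t - (a * t + c) = 0" if "t \<in> {u..v}" for t
  proof (rule continuous_constant_on_closure[where f = "\<lambda>t. F t - (a * t + c)"])
    show "continuous_on (closure {u<..<v}) (\<lambda>t. F t - (a * t + c))"
      using assms(1) by (intro continuous_intros) (auto intro: continuous_on_subset)
  qed (use that \<open>u < v\<close> ac in auto)
  then show ?thesis by (intro exI[of _ a] exI[of _ c]) auto
qed

lemma ex_step_right:
  fixes B :: "nat \<Rightarrow> real"
  assumes "B 1 \<le> y" "y < B (Suc m)"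
  shows "\<exists>i\<in>{1..m}. B i \<le> y \<and> y < B (Suc i)"
  using assms
proof (induction m)
  case (Suc m)
  show ?case
  proof (cases "y < B (Suc m)")
    case True
    then show ?thesis using Suc by force
  next
    case False
    then show ?thesis using Suc.prems by (intro bexI[of _ "Suc m"]) auto
  qed
qed simp

lemma ex_step_left:
  fixes B :: "nat \<Rightarrow> real"
  assumes "B 1 < y" "y \<le> B (Suc m)"
  shows "\<exists>i\<in>{1..m}. B i < y \<and> y \<le> B (Suc i)"
  using assms
proof (induction m)
  case (Suc m)
  show ?case
  proof (cases "y \<le> B (Suc m)")
    case True
    then show ?thesis using Suc by force
  next
    case False
    then show ?thesis using Suc.prems by (intro bexI[of _ "Suc m"]) auto
  qed
qed simp

context
  fixes F f :: "real \<Rightarrow> real" and n :: nat and b :: "nat \<Rightarrow> real"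
  assumes F: "is_lift F f" and pwl: "pwl F n b"
begin

text \<open>
  Adding the translate of the first break point makes the piece that wraps around the circle an
  ordinary interval between consecutive values.
\<close>

definition "closed_break i = (if i \<le> n then b i else b 1 + 1)"

lemma break_in: "i \<in> {1..n} \<Longrightarrow> b i \<in> {0..<1}"
proof -
  assume i: "i \<in> {1..n}"
  have sm: "mono_on {1..n} b"
    using pwl by (auto simp: pwl_def intro: strict_mono_on_imp_mono_on)
  have "b 1 \<le> b i" "b i \<le> b n" using i by (auto intro!: mono_onD[OF sm])
  then show "b i \<in> {0..<1}" using pwl by (auto simp: pwl_def)
qed

lemma affine_on_pieces:
  assumes i: "i \<in> {1..n}"
  shows "\<exists>a c. \<forall>t\<in>{closed_break i..closed_break (Suc i)}. F t = a * t + c"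
proof (rule affine_map_on_closed_interval)
  show "continuous_on UNIV F" using F by (simp add: is_lift_def)
  show "closed_break i < closed_break (Suc i)"
  proof (cases "i = n")
    case True
    then show ?thesis using break_in[of n] break_in[of 1] i by (auto simp: closed_break_def)
  next
    case False
    then show ?thesis
      using i pwl by (auto simp: closed_break_def pwl_def intro!: strict_mono_onD[of "{1..n}" b])
  qed
  show "affine_map_on {closed_break i<..<closed_break (Suc i)} F"
    using i pwl by (cases "i = n") (auto simp: closed_break_def pwl_def)
qed

lemma affine_on_translate:
  assumes "\<And>t. t \<in> {u..v} \<Longrightarrow> F t = a * t + c" and "t \<in> {u + of_int k..v + of_int k}"
  shows "F t = a * t + (c + of_int k - a * of_int k)"
proof -
  have "F (t - of_int k) = a * (t - of_int k) + c" using assms by auto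
  then show ?thesis
    using lift_add_int[OF F, of "t - of_int k" k] by (simp add: algebra_simps)
qed

text \<open>
  Rounding \<open>x - b 1\<close> down translates \<open>x\<close> into \<open>{b 1..<b 1 + 1}\<close>, where the affine piece found
  always extends to the right of the point.  It extends to the left as well unless the point is the
  break at which the piece starts; this makes the jump \<open>1\<close> elsewhere.
\<close>

lemma piece_right:
  "\<exists>u v a c. u \<le> x \<and> x < v \<and> (frac x \<notin> b ` {1..n} \<longrightarrow> u < x) \<and>
     (\<forall>t\<in>{u..v}. F t = a * t + c)"
proof -
  define k where "k = \<lfloor>x - b 1\<rfloor>"
  define y where "y = x - of_int k"
  have n: "2 \<le> n" using pwl by (simp add: pwl_def)
  have "b 1 \<le> y" "y < b 1 + 1"
    unfolding y_def k_def by linarith+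
  then have "closed_break 1 \<le> y" "y < closed_break (Suc n)"
    using n by (auto simp: closed_break_def)
  from ex_step_right[OF this] obtain i where i: "i \<in> {1..n}"
    and iy: "closed_break i \<le> y" "y < closed_break (Suc i)" by blast
  from affine_on_pieces[OF i] obtain a c
    where ac: "\<And>t. t \<in> {closed_break i..closed_break (Suc i)} \<Longrightarrow> F t = a * t + c" by blast
  have "closed_break i + of_int k \<noteq> x" if "frac x \<notin> b ` {1..n}"
  proof
    assume "closed_break i + of_int k = x"
    then have "y = b i" using i by (simp add: closed_break_def y_def)
    then have "frac x = b i"
      using frac_eq_add_int[of x y k] break_in[OF i] by (simp add: y_def)
    then show False using that i by blast
  qed
  moreover have "closed_break i + of_int k \<le> x" "x < closed_break (Suc i) + of_int k"
    using iy by (simp_all add: y_def)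
  moreover have "\<forall>t\<in>{closed_break i + of_int k..closed_break (Suc i) + of_int k}.
      F t = a * t + (c + of_int k - a * of_int k)"
    using affine_on_translate[OF ac] by blast
  ultimately show ?thesis
    by (intro exI[of _ "closed_break i + of_int k"] exI[of _ "closed_break (Suc i) + of_int k"]
          exI[of _ a] exI[of _ "c + of_int k - a * of_int k"]) (simp add: order_less_le)
qed

text \<open>
  Here \<open>x\<close> has to be translated into \<open>{b 1<..b 1 + 1}\<close> instead, so that the piece to the left of
  \<open>b 1\<close> is the last one of the period.
\<close>

lemma piece_left:
  "\<exists>u v a c. u < x \<and> x \<le> v \<and> (\<forall>t\<in>{u..v}. F t = a * t + c)"
proof -
  define k where "k = \<lceil>x - b 1\<rceil> - 1"
  define y where "y = x - of_int k"
  have n: "2 \<le> n" using pwl by (simp add: pwl_def)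
  have "b 1 < y" "y \<le> b 1 + 1"
    unfolding y_def k_def by linarith+
  then have "closed_break 1 < y" "y \<le> closed_break (Suc n)"
    using n by (auto simp: closed_break_def)
  from ex_step_left[OF this] obtain i where i: "i \<in> {1..n}"
    and iy: "closed_break i < y" "y \<le> closed_break (Suc i)" by blast
  from affine_on_pieces[OF i] obtain a c
    where ac: "\<And>t. t \<in> {closed_break i..closed_break (Suc i)} \<Longrightarrow> F t = a * t + c" by blast
  show ?thesis
    using iy affine_on_translate[OF ac]
    by (intro exI[of _ "closed_break i + of_int k"] exI[of _ "closed_break (Suc i) + of_int k"]
          exI[of _ a] exI[of _ "c + of_int k - a * of_int k"]) (force simp: y_def)
qed

lemma right_slope_derivative: "(F has_real_derivative right_slope F x) (at_right x)"
  and right_slope_pos: "0 < right_slope F x"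
  and right_slope_add_int: "right_slope F (x + of_int k) = right_slope F x"
proof -
  obtain u v a c where uv: "u \<le> x" "x < v" and ac: "\<And>t. t \<in> {u..v} \<Longrightarrow> F t = a * t + c"
    using piece_right[of x] by blast
  note slope = right_slope_of_affine[OF uv ac]
  show "(F has_real_derivative right_slope F x) (at_right x)" using slope by simp
  show "0 < right_slope F x"
    using strict_mono_affine_slope_pos[of F u v a c] F uv ac slope by (simp add: is_lift_def)
  have "right_slope F (x + of_int k) = a"
    by (rule right_slope_of_affine(1)[OF _ _ affine_on_translate[where k = k, OF ac]]) (use uv in auto)
  then show "right_slope F (x + of_int k) = right_slope F x" using slope by simp
qed

lemma left_slope_derivative: "(F has_real_derivative left_slope F x) (at_left x)"
  and left_slope_pos: "0 < left_slope F x"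
  and left_slope_add_int: "left_slope F (x + of_int k) = left_slope F x"
proof -
  obtain u v a c where uv: "u < x" "x \<le> v" and ac: "\<And>t. t \<in> {u..v} \<Longrightarrow> F t = a * t + c"
    using piece_left[of x] by blast
  note slope = left_slope_of_affine[OF uv ac]
  show "(F has_real_derivative left_slope F x) (at_left x)" using slope by simp
  show "0 < left_slope F x"
    using strict_mono_affine_slope_pos[of F u v a c] F uv ac slope by (simp add: is_lift_def)
  have "left_slope F (x + of_int k) = a"
    by (rule left_slope_of_affine(1)[OF _ _ affine_on_translate[where k = k, OF ac]]) (use uv in auto)
  then show "left_slope F (x + of_int k) = left_slope F x" using slope by simp
qed

lemma jump_pos: "0 < jump F x"
  by (simp add: jump_def right_slope_pos left_slope_pos)

lemma jump_frac: "jump F (frac x) = jump F x"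
  using right_slope_add_int[of x "- \<lfloor>x\<rfloor>"] left_slope_add_int[of x "- \<lfloor>x\<rfloor>"]
  by (simp add: jump_def frac_def)

lemma jump_break: "i \<in> {1..n} \<Longrightarrow> jump F (b i) \<noteq> 1"
  using pwl left_slope_pos[of "b i"] by (auto simp: pwl_def jump_def)

lemma jump_off_breaks:
  assumes "frac x \<notin> b ` {1..n}"
  shows "jump F x = 1"
proof -
  obtain u v a c where uv: "u < x" "x < v" and ac: "\<And>t. t \<in> {u..v} \<Longrightarrow> F t = a * t + c"
    using piece_right[of x] assms by blast
  then have "right_slope F x = a" "left_slope F x = a"
    using right_slope_of_affine(1)[of u x v F a c] left_slope_of_affine(1)[of u x v F a c] by auto
  then show ?thesis using left_slope_pos[of x] by (simp add: jump_def)
qed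

text \<open>
  The slopes are read off along the lifted orbit \<open>F\<^sup>j(x)\<close>; by periodicity the jumps there are those
  along the orbit on the circle.
\<close>

lemma prod_jumps_along_period:
  assumes id: "\<And>x. x \<in> {0..<1} \<Longrightarrow> (f ^^ q) x = x" and x: "x \<in> {0..<1}"
  shows "(\<Prod>j<q. jump F ((f ^^ j) x)) = 1"
proof -
  obtain m where m: "\<And>x. (F ^^ q) x = x + of_int m"
    using lift_of_identity[OF is_lift_funpow[OF F]] id by blast
  have "F ` {x<..} \<subseteq> {F x<..}" "F ` {..<x} \<subseteq> {..<F x}" for x
    using F by (auto simp: is_lift_def strict_mono_def)
  then have "(\<Prod>j<q. right_slope F ((F ^^ j) x)) = 1" "(\<Prod>j<q. left_slope F ((F ^^ j) x)) = 1"
    using prod_one_sided_slopes[where T = greaterThan, OF right_slope_derivative _ _ m]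
      prod_one_sided_slopes[where T = lessThan, OF left_slope_derivative _ _ m] by simp_all
  then have "(\<Prod>j<q. jump F ((F ^^ j) x)) = 1"
    by (simp add: jump_def prod_dividef)
  moreover have "jump F ((f ^^ j) x) = jump F ((F ^^ j) x)" for j
    using is_lift_funpow[OF F, of j] x jump_frac by (simp add: is_lift_def)
  ultimately show ?thesis by simp
qed

section \<open>Break points on a periodic orbit\<close>

text \<open>
  The common period \<open>q\<close> of all points may be a proper multiple of the least period \<open>d\<close> of \<open>x\<close>,
  and only \<open>F\<^sup>q\<close> is known to have slope \<open>1\<close>.  Comparing the product over \<open>d q\<close> steps,
  grouped by \<open>d\<close> and by \<open>q\<close>, passes from \<open>q\<close> to \<open>d\<close>.
\<close>

lemma prod_jumps_orbit:
  assumes id: "\<And>x. x \<in> {0..<1} \<Longrightarrow> (f ^^ q) x = x" and q: "1 \<le> q" and x: "x \<in> {0..<1}"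
  shows "(\<Prod>y\<in>orbit f x. jump F y) = 1"
proof -
  define d where "d = funpow_dist1 f x x"
  have self: "x \<in> orbit f x"
    using id[OF x] q by (auto simp: orbit_altdef intro!: exI[of _ q])
  have d: "(f ^^ d) x = x" unfolding d_def using self by (rule funpow_dist1_prop)
  define P where "P = (\<Prod>j<d. jump F ((f ^^ j) x))"
  have "P ^ q = (\<Prod>j<q. jump F ((f ^^ j) x)) ^ d"
    unfolding P_def
    using prod_along_repeated_period[of d f x "jump F" q, OF d]
      prod_along_repeated_period[of q f x "jump F" d, OF id[OF x]]
    by (simp add: mult.commute)
  also have "\<dots> = 1" using prod_jumps_along_period[OF id x] by simp
  finally have "P ^ q = 1 ^ q" by simp
  moreover have "0 < P" unfolding P_def by (simp add: prod_pos jump_pos)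
  ultimately have "P = 1" using q by (intro power_eq_imp_eq_base[of P q 1]) auto
  moreover have "(\<Prod>y\<in>orbit f x. jump F y) = P"
    using prod.reindex[OF inj_on_funpow_dist1[OF self], of "jump F"]
      orbit_conv_funpow_dist1[OF self]
    by (simp add: P_def d_def atLeast0LessThan)
  ultimately show ?thesis by simp
qed

text \<open>
  Break points are distinct points of the orbit, and the other points of the orbit contribute
  factors \<open>1\<close>.
\<close>

lemma prod_jumps_breaks_on_orbit:
  assumes id: "\<And>x. x \<in> {0..<1} \<Longrightarrow> (f ^^ q) x = x" and q: "1 \<le> q" and x: "x \<in> {0..<1}"
  shows "(\<Prod>i | i \<in> {1..n} \<and> b i \<in> orbit f x. jump F (b i)) = 1"
proof -
  let ?S = "{i. i \<in> {1..n} \<and> b i \<in> orbit f x}"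
  have self: "x \<in> orbit f x"
    using id[OF x] q by (auto simp: orbit_altdef intro!: exI[of _ q])
  have "strict_mono_on {1..n} b" using pwl by (simp add: pwl_def)
  then have inj: "inj_on b ?S"
    by (auto dest!: strict_mono_on_imp_inj_on intro: inj_on_subset)
  have orbit_in: "y \<in> {0..<1}" if y: "y \<in> orbit f x" for y
  proof -
    obtain k where "y = (f ^^ k) x" using y by (auto simp: orbit_altdef)
    then show ?thesis using is_lift_funpow[OF F, of k] x by (simp add: is_lift_def frac_lt_1)
  qed
  have "(\<Prod>i\<in>?S. jump F (b i)) = (\<Prod>y\<in>b ` ?S. jump F y)"
    using prod.reindex[OF inj, of "jump F"] by simp
  also have "\<dots> = (\<Prod>y\<in>orbit f x. jump F y)"
  proof (rule prod.mono_neutral_left)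
    show "finite (orbit f x)" using self by (rule finite_orbit)
    show "\<forall>y\<in>orbit f x - b ` ?S. jump F y = 1"
      using orbit_in by (auto intro!: jump_off_breaks)
  qed auto
  also have "\<dots> = 1" by (rule prod_jumps_orbit[OF id q x])
  finally show ?thesis .
qed

text \<open>
  If \<open>b i\<close> were the only break point on the orbit, the product above would consist of its jump alone,
  which is not \<open>1\<close>.
\<close>

lemma two_breaks_on_orbit:
  assumes id: "\<And>x. x \<in> {0..<1} \<Longrightarrow> (f ^^ q) x = x" and q: "1 \<le> q" and x: "x \<in> {0..<1}"
    and i: "i \<in> {1..n}" "b i \<in> orbit f x"
  shows "2 \<le> card {i. i \<in> {1..n} \<and> b i \<in> orbit f x}" (is "2 \<le> card ?S")
proof -
  define S where "S = ?S"
  have "finite S" "i \<in> S" using i by (auto simp: S_def)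
  have "card S \<noteq> 1"
  proof
    assume "card S = 1"
    then obtain z where "S = {z}" by (rule card_1_singletonE)
    then have "S = {i}" using \<open>i \<in> S\<close> by simp
    then have "jump F (b i) = 1"
      using prod_jumps_breaks_on_orbit[OF id q x] by (simp add: S_def)
    then show False using jump_break i by blast
  qed
  moreover have "0 < card S"
    using \<open>finite S\<close> \<open>i \<in> S\<close> by (auto simp: card_gt_0_iff)
  ultimately have "2 \<le> card S" by linarith
  then show ?thesis by (simp add: S_def)
qed

end

section \<open>The partition into orbit classes\<close>

lemma card_fibres_bound:
  assumes "finite A" and "\<And>x. x \<in> A \<Longrightarrow> m \<le> card {z \<in> A. g z = g x}"
  shows "m * card (g ` A) \<le> card A"
proof -
  have "m * card (g ` A) \<le> (\<Sum>y\<in>g ` A. card {z \<in> A. g z = y})"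
    using sum_bounded_below[of "g ` A" m "\<lambda>y. card {z \<in> A. g z = y}"] assms(2)
    by (auto simp: mult.commute)
  also have "\<dots> = card A"
    using sum.image_gen[OF assms(1), of "\<lambda>_. 1::nat" g] by simp
  finally show ?thesis .
qed

theorem theorem2p3:
  fixes f F :: "real \<Rightarrow> real" and n :: nat and b :: "nat \<Rightarrow> real"
  assumes "orientation_preserving_homeo f"
    and "is_lift F f"
    and "pwl F n b"
    and "rotation_number F \<in> \<rat>"
    and "\<exists>\<omega>\<in>\<rat>. topologically_conjugate f (rigid_rotation \<omega>)"
  shows "\<exists>(K::nat) (S :: nat \<Rightarrow> nat set).
           1 \<le> K \<and> real K \<le> real n / 2 \<and>
           (\<Union>r\<in>{1..K}. S r) = {1..n} \<and> disjoint_family_on S {1..K} \<and>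
           (\<forall>r\<in>{1..K}. 2 \<le> card (S r) \<and>
              (\<forall>u\<in>S r. \<forall>v\<in>S r. \<exists>A. periodic_orbit f A \<and> b u \<in> A \<and> b v \<in> A) \<and>
              trivial_cancellations F n b (S r))"
proof -
  note F = \<open>is_lift F f\<close> and pwl = \<open>pwl F n b\<close>
  obtain q where q: "1 \<le> q" and id: "\<And>x. x \<in> {0..<1} \<Longrightarrow> (f ^^ q) x = x"
    using periodic_of_conjugate_rational_rotation[OF F] assms(5) by blast
  define orb where "orb i = orbit f (b i)" for i
  have b_in: "b i \<in> {0..<1}" if "i \<in> {1..n}" for i
    using break_in[OF F pwl that] .
  have self: "x \<in> orbit f x" if "x \<in> {0..<1}" for x
    using id[OF that] q by (auto simp: orbit_altdef intro!: exI[of _ q])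
  have orb_eq: "orb i = orb j \<longleftrightarrow> b i \<in> orb j" if "i \<in> {1..n}" "j \<in> {1..n}" for i j
  proof
    show "b i \<in> orb j" if "orb i = orb j"
      using self[OF b_in[OF \<open>i \<in> {1..n}\<close>]] that by (simp add: orb_def)
    have "cyclic_on f (orb j)"
      unfolding orb_def using self[OF b_in[OF \<open>j \<in> {1..n}\<close>]] by (rule cyclic_on_singleI) simp
    then show "orb i = orb j" if "b i \<in> orb j"
      using that unfolding orb_def[of i] by (rule orbit_cyclic_eq3)
  qed
  (* Periodic orbits are equal or disjoint, so the classes are the fibres of orb. *)
  define cls where "cls A = {i \<in> {1..n}. orb i = A}" for A
  have cls: "cls (orb j) = {i. i \<in> {1..n} \<and> b i \<in> orbit f (b j)}" if "j \<in> {1..n}" for j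
    unfolding cls_def using orb_eq that by (auto simp: orb_def)
  have card2: "2 \<le> card (cls (orb j))" if "j \<in> {1..n}" for j
    using two_breaks_on_orbit[OF F pwl id q b_in[OF that] that] self[OF b_in[OF that]]
    by (simp add: cls[OF that])
  have triv: "trivial_cancellations F n b (cls (orb j))" if j: "j \<in> {1..n}" for j
    using prod_jumps_breaks_on_orbit[OF F pwl id q b_in[OF j]] card2[OF j]
    unfolding trivial_cancellations_def by (auto simp: cls[OF j])
  have same: "\<exists>A. periodic_orbit f A \<and> b u \<in> A \<and> b v \<in> A"
    if j: "j \<in> {1..n}" and uv: "u \<in> cls (orb j)" "v \<in> cls (orb j)" for j u v
  proof (intro exI conjI)
    have "orb j = range (\<lambda>k. (f ^^ k) (b j))"
      unfolding orb_def orbit_altdef_self_in[OF self[OF b_in[OF j]]] by auto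
    then show "periodic_orbit f (orb j)"
      unfolding periodic_orbit_def using q id b_in[OF j] by blast
    show "b u \<in> orb j" "b v \<in> orb j"
      using uv unfolding cls[OF j] by (auto simp: orb_def)
  qed
  define K where "K = card (orb ` {1..n})"
  obtain e where e: "bij_betw e {1..K} (orb ` {1..n})"
    using ex_bij_betw_nat_finite_1[of "orb ` {1..n}"] by (auto simp: K_def)
  have ex: "\<exists>j\<in>{1..n}. e r = orb j" if "r \<in> {1..K}" for r
    using bij_betwE[OF e] that by blast
  have "1 \<le> K"
    using pwl by (auto simp: K_def pwl_def Suc_le_eq card_gt_0_iff)
  moreover have "real K \<le> real n / 2"
    using card_fibres_bound[of "{1..n}" 2 orb] card2 by (simp add: K_def cls_def)
  moreover have "(\<Union>r\<in>{1..K}. cls (e r)) = {1..n}"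
  proof -
    have "(\<Union>r\<in>{1..K}. cls (e r)) = (\<Union>A\<in>orb ` {1..n}. cls A)"
      unfolding bij_betw_imp_surj_on[OF e, symmetric] by simp
    also have "\<dots> = {1..n}" by (auto simp: cls_def)
    finally show ?thesis .
  qed
  moreover have "disjoint_family_on (\<lambda>r. cls (e r)) {1..K}"
    unfolding disjoint_family_on_def
  proof (intro ballI impI)
    fix r s assume "r \<in> {1..K}" "s \<in> {1..K}" "r \<noteq> s"
    then have "e r \<noteq> e s" using bij_betw_imp_inj_on[OF e] by (metis inj_onD)
    then show "cls (e r) \<inter> cls (e s) = {}" by (auto simp: cls_def)
  qed
  moreover have "2 \<le> card (cls (e r)) \<and>
      (\<forall>u\<in>cls (e r). \<forall>v\<in>cls (e r). \<exists>A. periodic_orbit f A \<and> b u \<in> A \<and> b v \<in> A) \<and>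
      trivial_cancellations F n b (cls (e r))" if r: "r \<in> {1..K}" for r
  proof -
    obtain j where j: "j \<in> {1..n}" and "e r = orb j" using ex[OF r] by blast
    then show ?thesis using card2[OF j] triv[OF j] same[OF j] by simp
  qed
  ultimately show ?thesis
    by (intro exI[of _ K] exI[of _ "\<lambda>r. cls (e r)"]) blast
qed

end
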